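(* The coproduct $\Delta$ on $\textsf{ParSym}$ is coassociative: $(\Delta \otimes \mathrm{id}) \circ \Delta = (\mathrm{id} \otimes \Delta) \circ \Delta$.
   Context: Partition diagrams of order $k$ are set partitions of $\{1,\ldots,k,1',\ldots,k'\}$; $A_k$ is the set of them, $A_0=\{\varnothing\}$. For $\pi$ of order $k$, $\rho$ of order $l$: $\pi\otimes\rho$ (order $k+l$) has as blocks the blocks of $\pi$ and the blocks of $\rho$ shifted by $k$ ($i\mapsto i+k$, $i'\mapsto (i+k)'$). A diagram is $\otimes$-irreducible if it is not $\rho^{(1)}\otimes\rho^{(2)}$ with both factors nonempty. For nonempty $\pi,\rho$ (orders $k,l$), $\pi\bullet\rho$ is obtained from $\pi\otimes\rho$ by merging the block containing $k'$ with the block containing $(k+1)'$; $\varnothing\bullet\rho=\rho$, $\pi\bullet\varnothing=\pi$. Over a field $\mathbbm{k}$, $\textsf{ParSym}$ is the vector space with basis $\{\textsf{H}_\pi : \pi \in A_i, i \geq 0\}$ and product $\textsf{H}_\pi\textsf{H}_\rho = \textsf{H}_{\pi\otimes\rho}$, unit $\textsf{H}_\varnothing$; it is the free algebra on the $\textsf{H}_\pi$ with $\pi$ nonempty $\otimes$-irreducible. The coproduct $\Delta:\textsf{ParSym}\to\textsf{ParSym}\otimes\textsf{ParSym}$ is the algebra morphism defined on generators by $\Delta \textsf{H}_\pi = \sum \textsf{H}_{G_1}\otimes\textsf{H}_{G_2}$ for nonempty $\otimes$-irreducible $\pi$, the sum over all ordered pairs $(G_1,G_2)$ of diagrams, each either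 $\varnothing$ or $\otimes$-irreducible, with $G_1 \bullet G_2 = \pi$; and $\Delta\textsf{H}_\varnothing = \textsf{H}_\varnothing\otimes\textsf{H}_\varnothing$. *)

theory Defs
  imports
    Complex_Main
    "HOL-Library.Disjoint_Sets"
    "HOL-Library.Poly_Mapping"
    "HOL-Library.Product_Plus"
begin

section \<open>Partition diagrams\<close>

datatype vertex = Unprimed nat | Primed nat

definition vertices :: "nat \<Rightarrow> vertex set" where
  "vertices k = Unprimed ` {1..k} \<union> Primed ` {1..k}"

(* A diagram of order k is stored as the pair of k and a set partition of 1..k, 1'..k'. *)
typedef diagram = "{(k, P). partition_on (vertices k) P}"
  by (rule exI[of _ "(0, {})"]) (simp add: vertices_def partition_on_empty)

setup_lifting type_definition_diagram

lift_definition diagram_order :: "diagram \<Rightarrow> nat" is fst .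

lift_definition blocks :: "diagram \<Rightarrow> vertex set set" is snd .

lift_definition empty_diagram :: diagram is "(0, {})"
  by (simp add: vertices_def partition_on_empty)

fun shift :: "nat \<Rightarrow> vertex \<Rightarrow> vertex" where
  "shift k (Unprimed i) = Unprimed (i + k)"
| "shift k (Primed i) = Primed (i + k)"

definition juxtapose :: "nat \<Rightarrow> vertex set set \<Rightarrow> vertex set set \<Rightarrow> vertex set set" where
  "juxtapose k P Q = P \<union> (\<lambda>B. shift k ` B) ` Q"

(* Union of the block containing u and the block containing v. *)
definition merge_blocks :: "vertex \<Rightarrow> vertex \<Rightarrow> vertex set set \<Rightarrow> vertex set set" where
  "merge_blocks u v P =
    {B \<in> P. u \<notin> B \<and> v \<notin> B} \<union> {\<Union>{B \<in> P. u \<in> B \<or> v \<in> B}}"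

lemma inj_shift: "inj (shift k)"
proof (rule injI)
  fix x y assume "shift k x = shift k y"
  then show "x = y" by (cases x; cases y) auto
qed

lemma vertices_add: "vertices (k + l) = vertices k \<union> shift k ` vertices l"
proof -
  have *: "{1..k + l} = {1..k} \<union> (\<lambda>i. i + k) ` {1..l}"
    by (auto simp: image_iff)
  show ?thesis
    unfolding vertices_def * by (simp only: image_Un image_image shift.simps Un_ac)
qed

lemma vertices_shift_disjoint: "vertices k \<inter> shift k ` vertices l = {}"
  by (auto simp: vertices_def)

lemma partition_on_shift:
  assumes "partition_on A Q"
  shows "partition_on (shift k ` A) ((\<lambda>B. shift k ` B) ` Q)"
  using assms unfolding partition_on_def disjoint_def
  by (auto simp: image_Int[OF inj_shift, symmetric])

lemma partition_on_juxtapose: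
  assumes "partition_on (vertices k) P" "partition_on (vertices l) Q"
  shows "partition_on (vertices (k + l)) (juxtapose k P Q)"
proof (rule partition_onI)
  let ?Q = "(\<lambda>B. shift k ` B) ` Q"
  note P = assms(1) and Q = partition_on_shift[OF assms(2), of k]
  have UP: "\<Union>P = vertices k" and UQ: "\<Union>?Q = shift k ` vertices l"
    using partition_onD1[OF P] partition_onD1[OF Q] by simp_all
  show "\<Union>(juxtapose k P Q) = vertices (k + l)"
    using UP UQ
    unfolding vertices_add juxtapose_def by (simp add: Union_Un_distrib)
  have PQ: "disjnt p q" if "p \<in> P" "q \<in> ?Q" for p q
    using that UP UQ vertices_shift_disjoint[of k l] unfolding disjnt_def by blast
  show "disjnt p q" if "p \<in> juxtapose k P Q" "q \<in> juxtapose k P Q" "p \<noteq> q" for p q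
  proof -
    have "p \<in> P \<or> p \<in> ?Q" "q \<in> P \<or> q \<in> ?Q" using that by (auto simp: juxtapose_def)
    then show ?thesis
      using PQ[of p q] PQ[of q p] \<open>p \<noteq> q\<close>
        pairwiseD[OF partition_onD2[OF P], of p q] pairwiseD[OF partition_onD2[OF Q], of p q]
      by (metis disjnt_sym)
  qed
next
  show "{} \<notin> juxtapose k P Q"
    using partition_onD3[OF assms(1)] partition_onD3[OF assms(2)] by (auto simp: juxtapose_def)
qed

lemma partition_on_merge_blocks:
  assumes "partition_on A P" "u \<in> A"
  shows "partition_on A (merge_blocks u v P)"
proof (rule partition_onI)
  show "\<Union>(merge_blocks u v P) = A"
    using partition_onD1[OF assms(1)] unfolding merge_blocks_def by blast
next
  fix p q assume "p \<in> merge_blocks u v P" "q \<in> merge_blocks u v P" "p \<noteq> q"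
  then show "disjnt p q"
    using partition_onD2[OF assms(1)] unfolding merge_blocks_def disjnt_def disjoint_def
    by blast
next
  show "{} \<notin> merge_blocks u v P"
    using partition_onD1[OF assms(1)] partition_onD3[OF assms(1)] assms(2)
    unfolding merge_blocks_def by blast
qed

lemma Primed_in_vertices: "0 < k \<Longrightarrow> Primed k \<in> vertices (k + l)"
  by (auto simp: vertices_def)

lift_definition diagram_tensor :: "diagram \<Rightarrow> diagram \<Rightarrow> diagram" is
  "\<lambda>(k, P) (l, Q). (k + l, juxtapose k P Q)"
  by (auto intro: partition_on_juxtapose)

lift_definition diagram_bullet :: "diagram \<Rightarrow> diagram \<Rightarrow> diagram" is
  "\<lambda>(k, P) (l, Q).
    if k = 0 then (l, Q) else if l = 0 then (k, P)
    else (k + l, merge_blocks (Primed k) (Primed (k + 1)) (juxtapose k P Q))"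
  by (auto split: if_splits intro!: partition_on_merge_blocks partition_on_juxtapose Primed_in_vertices)

lemma diagram_eqI:
  "diagram_order x = diagram_order y \<Longrightarrow> blocks x = blocks y \<Longrightarrow> x = y"
  by transfer auto

lemma partition_on_blocks: "partition_on (vertices (diagram_order x)) (blocks x)"
  by transfer auto

(* The tensor product of diagrams is written additively, so that the library's convolution
   product on finitely supported functions over diagrams becomes the product of ParSym. *)
instantiation diagram :: monoid_add
begin

definition zero_diagram :: diagram where "0 = empty_diagram"

definition plus_diagram :: "diagram \<Rightarrow> diagram \<Rightarrow> diagram" where "(+) = diagram_tensor"

instance
proof
  have shift_shift: "shift k (shift l v) = shift (k + l) v" for k l v
    by (cases v) auto
  have shift_0: "shift 0 = id"
  proof
    fix v show "shift 0 v = id v" by (cases v) auto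
  qed
  fix x y z :: diagram
  show "x + y + z = x + (y + z)"
    unfolding plus_diagram_def
    by transfer (auto simp: juxtapose_def image_Un image_image shift_shift)
  show "0 + x = x" "x + 0 = x"
    unfolding plus_diagram_def zero_diagram_def
    by (transfer; auto simp: juxtapose_def shift_0)+
qed

end

lemma order_0 [simp]: "diagram_order 0 = 0"
  unfolding zero_diagram_def by transfer simp

lemma order_add [simp]: "diagram_order (x + y) = diagram_order x + diagram_order y"
  unfolding plus_diagram_def by transfer auto

lemma order_eq_0_iff [simp]: "diagram_order x = 0 \<longleftrightarrow> x = 0"
  unfolding zero_diagram_def by transfer (auto simp: vertices_def partition_on_empty)

lemma order_bullet: "diagram_order (diagram_bullet x y) = diagram_order x + diagram_order y"
  by transfer auto

(* The empty diagram 0 satisfies this vacuously. *)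
definition tensor_irreducible :: "diagram \<Rightarrow> bool" where
  "tensor_irreducible \<pi> \<longleftrightarrow> \<not> (\<exists>\<rho>1 \<rho>2. \<rho>1 \<noteq> 0 \<and> \<rho>2 \<noteq> 0 \<and> \<pi> = \<rho>1 + \<rho>2)"

definition bullet_factorizations :: "diagram \<Rightarrow> (diagram \<times> diagram) set" where
  "bullet_factorizations \<pi> =
    {(G1, G2). (G1 = 0 \<or> tensor_irreducible G1) \<and> (G2 = 0 \<or> tensor_irreducible G2)
      \<and> diagram_bullet G1 G2 = \<pi>}"

(* Needed because a sum over an infinite index set would be 0 by convention. *)
lemma finite_bullet_factorizations: "finite (bullet_factorizations \<pi>)"
proof -
  let ?n = "diagram_order \<pi>"
  let ?D = "{x. diagram_order x \<le> ?n}"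
  have "finite (vertices ?n)" by (simp add: vertices_def)
  then have fin: "finite ({..?n} \<times> Pow (Pow (vertices ?n)))" by simp
  have "(\<lambda>x. (diagram_order x, blocks x)) ` ?D \<subseteq> {..?n} \<times> Pow (Pow (vertices ?n))"
  proof (clarsimp)
    fix x B v assume "diagram_order x \<le> ?n" "B \<in> blocks x" "v \<in> B"
    then have "v \<in> vertices (diagram_order x)"
      using partition_onD1[OF partition_on_blocks[of x]] by blast
    then show "v \<in> vertices ?n"
      using \<open>diagram_order x \<le> ?n\<close> by (auto simp: vertices_def)
  qed
  moreover have "inj_on (\<lambda>x. (diagram_order x, blocks x)) ?D"
    by (auto intro!: inj_onI diagram_eqI)
  ultimately have "finite ?D"
    using fin by (blast intro: inj_on_finite)
  then have "finite (?D \<times> ?D)" by simp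
  moreover have "bullet_factorizations \<pi> \<subseteq> ?D \<times> ?D"
    by (auto simp: bullet_factorizations_def order_bullet)
  ultimately show ?thesis by (rule finite_subset[rotated])
qed


section \<open>Free vector spaces and their tensor products\<close>

(* The vector space with basis 'a over 'k is the type of finitely supported functions
   'a =>_0 'k, and the tensor product of the spaces with bases 'a and 'b is the one with
   basis 'a * 'b. *)

definition scale :: "'k::field \<Rightarrow> ('a \<Rightarrow>\<^sub>0 'k) \<Rightarrow> ('a \<Rightarrow>\<^sub>0 'k)" where
  "scale c x = Poly_Mapping.map ((*) c) x"

definition linear_extension ::
    "('a \<Rightarrow> ('b \<Rightarrow>\<^sub>0 'k::field)) \<Rightarrow> ('a \<Rightarrow>\<^sub>0 'k) \<Rightarrow> ('b \<Rightarrow>\<^sub>0 'k)" where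
  "linear_extension f x = (\<Sum>a\<in>Poly_Mapping.keys x. scale (Poly_Mapping.lookup x a) (f a))"

definition basis :: "'a \<Rightarrow> ('a \<Rightarrow>\<^sub>0 'k::field)" where
  "basis a = Poly_Mapping.single a 1"

definition tensor :: "('a \<Rightarrow>\<^sub>0 'k::field) \<Rightarrow> ('b \<Rightarrow>\<^sub>0 'k) \<Rightarrow> ('a \<times> 'b \<Rightarrow>\<^sub>0 'k)" where
  "tensor x y = linear_extension (\<lambda>a. linear_extension (\<lambda>b. basis (a, b)) y) x"

(* For linear maps f and g, this is their tensor product. *)
definition tensor_map ::
    "(('a \<Rightarrow>\<^sub>0 'k::field) \<Rightarrow> ('c \<Rightarrow>\<^sub>0 'k)) \<Rightarrow> (('b \<Rightarrow>\<^sub>0 'k) \<Rightarrow> ('d \<Rightarrow>\<^sub>0 'k))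
      \<Rightarrow> ('a \<times> 'b \<Rightarrow>\<^sub>0 'k) \<Rightarrow> ('c \<times> 'd \<Rightarrow>\<^sub>0 'k)" where
  "tensor_map f g = linear_extension (\<lambda>(a, b). tensor (f (basis a)) (g (basis b)))"

(* The canonical isomorphism from (U (x) V) (x) W to U (x) (V (x) W). *)
definition tensor_assoc ::
    "(('a \<times> 'b) \<times> 'c \<Rightarrow>\<^sub>0 'k::field) \<Rightarrow> ('a \<times> ('b \<times> 'c) \<Rightarrow>\<^sub>0 'k)" where
  "tensor_assoc = linear_extension (\<lambda>((a, b), c). basis (a, (b, c)))"

lemma lookup_scale [simp]: "Poly_Mapping.lookup (scale c x) a = c * Poly_Mapping.lookup x a"
  unfolding scale_def by (simp add: Poly_Mapping.map.rep_eq when_def)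

interpretation free_space: vector_space "scale :: 'k::field \<Rightarrow> ('a \<Rightarrow>\<^sub>0 'k) \<Rightarrow> ('a \<Rightarrow>\<^sub>0 'k)"
  by unfold_locales (auto intro!: poly_mapping_eqI simp: lookup_add algebra_simps)

lemma linear_extension_superset:
  fixes x :: "'a \<Rightarrow>\<^sub>0 'k::field"
  assumes "finite A" "Poly_Mapping.keys x \<subseteq> A"
  shows "linear_extension f x = (\<Sum>a\<in>A. scale (Poly_Mapping.lookup x a) (f a))"
  unfolding linear_extension_def
  by (rule sum.mono_neutral_left[OF assms]) (auto simp: in_keys_iff)

lemma linear_linear_extension:
  fixes f :: "'a \<Rightarrow> ('b \<Rightarrow>\<^sub>0 'k::field)"
  shows "Vector_Spaces.linear scale scale (linear_extension f)"
proof unfold_locales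
  fix x y :: "'a \<Rightarrow>\<^sub>0 'k"
  let ?A = "Poly_Mapping.keys x \<union> Poly_Mapping.keys y"
  have "Poly_Mapping.keys (x + y) \<subseteq> ?A" by (rule keys_add)
  then show "linear_extension f (x + y) = linear_extension f x + linear_extension f y"
    by (simp add: linear_extension_superset[of ?A] lookup_add free_space.scale_left_distrib
        sum.distrib)
next
  fix c and x :: "'a \<Rightarrow>\<^sub>0 'k"
  have "Poly_Mapping.keys (scale c x) \<subseteq> Poly_Mapping.keys x"
    by (auto simp: in_keys_iff)
  then show "linear_extension f (scale c x) = scale c (linear_extension f x)"
    by (simp add: linear_extension_superset[of "Poly_Mapping.keys x"] free_space.scale_sum_right)
qed

lemma linear_extension_basis [simp]: "linear_extension f (basis a) = f a"
  unfolding linear_extension_def basis_def by simp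

lemma tensor_basis [simp]: "tensor (basis a) (basis b) = basis (a, b)"
  by (simp add: tensor_def)

lemma basis_expansion:
  fixes x :: "'a \<Rightarrow>\<^sub>0 'k::field"
  shows "x = (\<Sum>a\<in>Poly_Mapping.keys x. scale (Poly_Mapping.lookup x a) (basis a))"
  by (rule poly_mapping_eqI)
    (auto simp: lookup_sum basis_def lookup_single when_def in_keys_iff
      if_distrib[of "\<lambda>z. _ * z"] sum.delta cong: if_cong)

lemma linear_eq_on_basis:
  assumes "Vector_Spaces.linear scale scale f" "Vector_Spaces.linear scale scale g"
    and eq: "\<And>a. f (basis a) = g (basis a)"
  shows "f = g"
proof
  fix x
  interpret f: Vector_Spaces.linear scale scale f by fact
  interpret g: Vector_Spaces.linear scale scale g by fact
  show "f x = g x"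
    using arg_cong[OF basis_expansion[of x], of f] arg_cong[OF basis_expansion[of x], of g]
    by (simp only: f.sum g.sum f.scale g.scale eq)
qed


section \<open>The algebra ParSym and its coproduct\<close>

(* The basis vector H_pi is basis pi. As diagrams form a monoid under the tensor product,
   written + with unit 0, the library's product and unit on 'k parsym satisfy
   basis pi * basis rho = basis (pi + rho) and 1 = basis 0.  The library's product on
   (diagram * diagram) =>_0 'k is that of the tensor product of algebras, because diagram pairs
   are added componentwise. *)
type_synonym 'k parsym = "diagram \<Rightarrow>\<^sub>0 'k"

lemma basis_mult: "basis a * basis b = basis (a + b)"
  for a b :: "'a::monoid_add"
  by (simp add: basis_def mult_single)

lemma basis_zero: "basis 0 = 1"
  by (simp add: basis_def)

definition algebra_morphism ::
    "(('a::monoid_add \<Rightarrow>\<^sub>0 'k::field) \<Rightarrow> ('b::monoid_add \<Rightarrow>\<^sub>0 'k)) \<Rightarrow> bool" where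
  "algebra_morphism f \<longleftrightarrow>
    Vector_Spaces.linear scale scale f \<and> f 1 = 1 \<and> (\<forall>x y. f (x * y) = f x * f y)"

definition is_coproduct :: "('k::field parsym \<Rightarrow> (diagram \<times> diagram \<Rightarrow>\<^sub>0 'k)) \<Rightarrow> bool" where
  "is_coproduct D \<longleftrightarrow> algebra_morphism D
    \<and> (\<forall>\<pi>. \<pi> \<noteq> 0 \<and> tensor_irreducible \<pi> \<longrightarrow>
        D (basis \<pi>) = (\<Sum>(G1, G2)\<in>bullet_factorizations \<pi>. tensor (basis G1) (basis G2)))
    \<and> D (basis 0) = tensor (basis 0) (basis 0)"

(* Well defined by ex1_is_coproduct below. *)
definition coproduct :: "'k::field parsym \<Rightarrow> (diagram \<times> diagram \<Rightarrow>\<^sub>0 'k)" where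
  "coproduct = (THE D. is_coproduct D)"


section \<open>Existence and uniqueness of the coproduct\<close>

lemma blocks_add: "blocks (x + y) = juxtapose (diagram_order x) (blocks x) (blocks y)"
  unfolding plus_diagram_def by transfer auto

lemma block_subset: "B \<in> blocks x \<Longrightarrow> B \<subseteq> vertices (diagram_order x)"
  using partition_onD1[OF partition_on_blocks[of x]] by blast

lemma block_nonempty: "B \<in> blocks x \<Longrightarrow> B \<noteq> {}"
  using partition_onD3[OF partition_on_blocks[of x]] by blast

lemma vertices_mono: "k \<le> l \<Longrightarrow> vertices k \<subseteq> vertices l"
  by (auto simp: vertices_def)

lemma shifted_block_not_block:
  assumes "shift l ` B \<in> blocks x" "diagram_order x \<le> l" "B \<in> blocks y"
  shows False
proof -
  obtain v where "v \<in> B" using block_nonempty[OF assms(3)] by blast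
  then have "shift l v \<in> vertices l"
    using block_subset[OF assms(1)] vertices_mono[OF assms(2)] by blast
  moreover have "shift l v \<in> shift l ` vertices (diagram_order y)"
    using \<open>v \<in> B\<close> block_subset[OF assms(3)] by blast
  ultimately show False using vertices_shift_disjoint by blast
qed

lemma blocks_add_shifted:
  "blocks y = {B. shift (diagram_order x) ` B \<in> blocks (x + y) - blocks x}"
proof (intro set_eqI iffI)
  fix B assume B: "B \<in> blocks y"
  then have "shift (diagram_order x) ` B \<in> blocks (x + y)"
    by (auto simp: blocks_add juxtapose_def)
  then show "B \<in> {B. shift (diagram_order x) ` B \<in> blocks (x + y) - blocks x}"
    using shifted_block_not_block[OF _ _ B, of "diagram_order x" x] by auto
next
  fix B assume "B \<in> {B. shift (diagram_order x) ` B \<in> blocks (x + y) - blocks x}"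
  then obtain B' where "B' \<in> blocks y" "shift (diagram_order x) ` B = shift (diagram_order x) ` B'"
    by (auto simp: blocks_add juxtapose_def)
  then show "B \<in> blocks y"
    by (simp add: inj_image_eq_iff[OF inj_shift])
qed

lemma diagram_add_left_cancel:
  assumes "x + y = x + z" shows "y = (z :: diagram)"
proof (rule diagram_eqI)
  show "diagram_order y = diagram_order z"
    using arg_cong[OF assms, of diagram_order] by simp
  show "blocks y = blocks z"
    unfolding blocks_add_shifted[of y x] blocks_add_shifted[of z x] assms ..
qed

lemma diagram_prefix:
  assumes eq: "a + b = c + d" and le: "diagram_order a \<le> diagram_order c"
  obtains e where "c = a + (e :: diagram)"
proof -
  let ?k = "diagram_order a" and ?l = "diagram_order c - diagram_order a"
  define Q where "Q = {B \<in> blocks b. shift ?k ` B \<in> blocks c}"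
  have "B \<in> blocks c" if B: "B \<in> blocks a" for B
  proof (rule ccontr)
    assume "B \<notin> blocks c"
    moreover have "B \<in> blocks (c + d)"
      unfolding eq[symmetric] using B by (simp add: blocks_add juxtapose_def)
    ultimately obtain B' where "B' \<in> blocks d" "B = shift (diagram_order c) ` B'"
      by (auto simp: blocks_add juxtapose_def)
    then show False using shifted_block_not_block B le by blast
  qed
  moreover have "B \<in> blocks a \<union> (\<lambda>B. shift ?k ` B) ` Q" if B: "B \<in> blocks c" for B
  proof -
    have "B \<in> blocks (a + b)" unfolding eq using B by (simp add: blocks_add juxtapose_def)
    then show ?thesis using B by (auto simp: blocks_add juxtapose_def Q_def)
  qed
  ultimately have bc: "blocks c = juxtapose ?k (blocks a) Q"
    unfolding juxtapose_def Q_def by blast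
  have order: "diagram_order c = ?k + ?l" using le by simp
  have vc: "vertices (diagram_order c) = vertices ?k \<union> shift ?k ` vertices ?l"
    using vertices_add[of ?k ?l] order by simp
  have "partition_on (vertices ?l) Q"
  proof (rule partition_onI)
    have dj: "\<Union>((\<lambda>B. shift ?k ` B) ` Q) \<inter> vertices ?k = {}"
      using vertices_shift_disjoint[of ?k "diagram_order b"] block_subset[of _ b]
      unfolding Q_def by blast
    have "\<Union>(blocks c) = vertices (diagram_order c)" "\<Union>(blocks a) = vertices ?k"
      using partition_onD1[OF partition_on_blocks] by blast+
    then have "vertices ?k \<union> \<Union>((\<lambda>B. shift ?k ` B) ` Q) = vertices ?k \<union> shift ?k ` vertices ?l"
      unfolding bc vc juxtapose_def by (simp only: Union_Un_distrib)
    with dj vertices_shift_disjoint[of ?k ?l]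
    have "\<Union>((\<lambda>B. shift ?k ` B) ` Q) = shift ?k ` vertices ?l"
      by (metis Int_Un_eq(2) Un_Diff Diff_cancel Un_empty_left Diff_triv Int_commute)
    then have "shift ?k ` \<Union>Q = shift ?k ` vertices ?l" by blast
    then show "\<Union>Q = vertices ?l" by (simp add: inj_image_eq_iff[OF inj_shift])
  next
    fix p q assume "p \<in> Q" "q \<in> Q" "p \<noteq> q"
    then show "disjnt p q"
      using partition_onD2[OF partition_on_blocks[of b]]
      unfolding Q_def disjoint_def disjnt_def by blast
  next
    show "{} \<notin> Q" unfolding Q_def using block_nonempty by blast
  qed
  then have "\<exists>e. diagram_order e = ?l \<and> blocks e = Q"
    by transfer auto
  then obtain e where e: "diagram_order e = ?l" "blocks e = Q" by blast
  have "c = a + e"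
    by (rule diagram_eqI) (use order e bc in \<open>auto simp: blocks_add\<close>)
  then show ?thesis by (rule that)
qed

abbreviation generator :: "diagram \<Rightarrow> bool" where
  "generator \<pi> \<equiv> \<pi> \<noteq> 0 \<and> tensor_irreducible \<pi>"

lemma generator_prefix_eq:
  assumes "a + b = c + d" "generator a" "generator c"
  shows "a = c"
proof -
  have "a = c" if asm: "a + b = c + d" "generator a" "generator c" "diagram_order a \<le> diagram_order c"
    for a b c d
  proof -
    obtain e where e: "c = a + e" using diagram_prefix[OF asm(1,4)] by blast
    then have "e = 0" using asm(2,3) unfolding tensor_irreducible_def by blast
    then show "a = c" using e by simp
  qed
  from this[of a b c d] this[of c d a b] show ?thesis
    using assms nat_le_linear[of "diagram_order a" "diagram_order c"] by auto
qed

lemma ex_factorization: "\<exists>xs. (\<forall>x\<in>set xs. generator x) \<and> sum_list xs = \<pi>"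
proof (induction "diagram_order \<pi>" arbitrary: \<pi> rule: less_induct)
  case less
  consider "\<pi> = 0" | "generator \<pi>" | a b where "a \<noteq> 0" "b \<noteq> 0" "\<pi> = a + b"
    unfolding tensor_irreducible_def by blast
  then show ?case
  proof cases
    case 1 then show ?thesis by (intro exI[of _ "[]"]) simp
  next
    case 2 then show ?thesis by (intro exI[of _ "[\<pi>]"]) simp
  next
    case 3
    then have "diagram_order a > 0" "diagram_order b > 0"
      by (metis neq0_conv order_eq_0_iff)+
    then have "diagram_order a < diagram_order \<pi>" "diagram_order b < diagram_order \<pi>"
      using 3(3) by auto
    then obtain xs ys where "\<forall>x\<in>set xs. generator x" "sum_list xs = a"
      "\<forall>x\<in>set ys. generator x" "sum_list ys = b"
      using less by meson
    then show ?thesis using 3 by (intro exI[of _ "xs @ ys"]) auto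
  qed
qed

lemma sum_list_generators_eq_0:
  assumes "\<forall>x\<in>set xs. generator x" "sum_list xs = 0"
  shows "xs = []"
proof (cases xs)
  case (Cons a ys)
  then have "diagram_order a + diagram_order (sum_list ys) = 0"
    using arg_cong[OF assms(2), of diagram_order] by simp
  then show ?thesis using assms(1) Cons by simp
qed

lemma factorization_unique:
  assumes "\<forall>x\<in>set xs. generator x" "\<forall>x\<in>set ys. generator x" "sum_list xs = sum_list ys"
  shows "xs = ys"
  using assms
proof (induction xs arbitrary: ys)
  case Nil
  then show ?case using sum_list_generators_eq_0[of ys] by simp
next
  case (Cons a xs)
  obtain b zs where ys: "ys = b # zs"
    using Cons.prems sum_list_generators_eq_0[of "a # xs"] by (cases ys) auto
  have gens: "generator a" "\<forall>x\<in>set xs. generator x" "generator b" "\<forall>x\<in>set zs. generator x"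
    using Cons.prems(1,2) unfolding ys by simp_all
  have eq: "a + sum_list xs = b + sum_list zs" using Cons.prems(3) ys by simp
  have "a = b" by (rule generator_prefix_eq[OF eq gens(1,3)])
  moreover have "sum_list xs = sum_list zs"
    using eq unfolding \<open>a = b\<close> by (rule diagram_add_left_cancel)
  ultimately show ?case using Cons.IH[OF gens(2,4)] ys by simp
qed

theorem ex1_is_coproduct:
  "\<exists>!D. is_coproduct (D :: 'k::field parsym \<Rightarrow> (diagram \<times> diagram \<Rightarrow>\<^sub>0 'k))"
proof (rule ex_ex1I)
  define factors where
    "factors \<pi> = (SOME xs. (\<forall>x\<in>set xs. generator x) \<and> sum_list xs = \<pi>)" for \<pi>
  have factors: "\<forall>x\<in>set (factors \<pi>). generator x" "sum_list (factors \<pi>) = \<pi>" for \<pi>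
    using someI_ex[OF ex_factorization[of \<pi>]] unfolding factors_def by blast+
  define gen :: "diagram \<Rightarrow> (diagram \<times> diagram \<Rightarrow>\<^sub>0 'k)" where
    "gen \<pi> = (\<Sum>(G1, G2)\<in>bullet_factorizations \<pi>. tensor (basis G1) (basis G2))" for \<pi>
  define g where "g \<pi> = prod_list (map gen (factors \<pi>))" for \<pi>
  have "factors (a + b) = factors a @ factors b" for a b
    by (rule factorization_unique) (use factors(1) in \<open>auto simp: factors(2)\<close>)
  then have g_add: "g (a + b) = g a * g b" for a b
    by (simp add: g_def)
  have "factors 0 = []"
    by (rule factorization_unique) (use factors(1) in \<open>auto simp: factors(2)\<close>)
  then have g_0: "g 0 = 1" by (simp add: g_def)
  have g_gen: "g \<pi> = gen \<pi>" if "generator \<pi>" for \<pi>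
  proof -
    have "factors \<pi> = [\<pi>]"
      by (rule factorization_unique) (use factors(1) that in \<open>auto simp: factors(2)\<close>)
    then show ?thesis by (simp add: g_def)
  qed
  interpret lin: Vector_Spaces.linear scale scale "linear_extension g"
    by (rule linear_linear_extension)
  have scale_mult: "scale c x * y = scale c (x * y)" "x * scale c y = scale c (x * y)"
    for c :: 'k and x y :: "'z::monoid_add \<Rightarrow>\<^sub>0 'k"
  proof -
    have sc: "scale c z = Poly_Mapping.single 0 c * z" for z :: "'z \<Rightarrow>\<^sub>0 'k"
      unfolding scale_def by (rule mult_map_scale_conv_mult)
    show 1: "scale c x * y = scale c (x * y)" by (simp add: sc mult.assoc)
    have comm: "z * Poly_Mapping.single 0 c = scale c z" for z :: "'z \<Rightarrow>\<^sub>0 'k"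
    proof -
      have "z * Poly_Mapping.single 0 c =
        (\<Sum>a\<in>Poly_Mapping.keys z. Poly_Mapping.single a (Poly_Mapping.lookup z a) * Poly_Mapping.single 0 c)"
        using arg_cong[OF basis_expansion[of z], of "\<lambda>u. u * Poly_Mapping.single 0 c"]
        by (simp only: sum_distrib_right basis_def scale_def map_single mult_1_right)
          (simp add: mult_1_right)
      also have "\<dots> = (\<Sum>a\<in>Poly_Mapping.keys z. Poly_Mapping.single 0 c * Poly_Mapping.single a (Poly_Mapping.lookup z a))"
        by (simp add: mult_single mult.commute)
      also have "\<dots> = scale c z"
        using arg_cong[OF basis_expansion[of z], of "\<lambda>u. Poly_Mapping.single 0 c * u"]
        by (simp add: sc[of z] sum_distrib_left basis_def) (simp add: scale_def)
      finally show ?thesis .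
    qed
    show "x * scale c y = scale c (x * y)"
      by (metis comm sc mult.assoc)
  qed
  have mult: "linear_extension g (x * y) = linear_extension g x * linear_extension g y" for x y
  proof -
    let ?K = Poly_Mapping.keys and ?c = Poly_Mapping.lookup
    have "x * y = (\<Sum>a\<in>?K x. scale (?c x a) (basis a)) * (\<Sum>b\<in>?K y. scale (?c y b) (basis b))"
      using basis_expansion[of x] basis_expansion[of y] by simp
    also have "\<dots> = (\<Sum>a\<in>?K x. \<Sum>b\<in>?K y. scale (?c y b) (scale (?c x a) (basis (a + b))))"
      by (simp only: sum_product scale_mult basis_mult)
    finally have "linear_extension g (x * y) =
        (\<Sum>a\<in>?K x. \<Sum>b\<in>?K y. scale (?c y b) (scale (?c x a) (g a * g b)))"
      by (simp only: lin.sum lin.scale linear_extension_basis g_add)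
    also have "\<dots> = linear_extension g x * linear_extension g y"
      unfolding linear_extension_def by (simp only: sum_product scale_mult)
    finally show ?thesis .
  qed
  have "is_coproduct (linear_extension g)"
    unfolding is_coproduct_def algebra_morphism_def
    using mult g_gen linear_linear_extension[of g]
    by (auto simp: gen_def g_0 basis_zero[symmetric] zero_prod_def)
  then show "\<exists>D. is_coproduct (D :: 'k parsym \<Rightarrow> (diagram \<times> diagram \<Rightarrow>\<^sub>0 'k))" by blast
next
  fix D E :: "'k parsym \<Rightarrow> (diagram \<times> diagram \<Rightarrow>\<^sub>0 'k)"
  assume D: "is_coproduct D" and E: "is_coproduct E"
  have "D (basis (sum_list xs)) = E (basis (sum_list xs))" if "\<forall>x\<in>set xs. generator x" for xs
    using that
    by (induction xs)
      (use D E in \<open>auto simp: is_coproduct_def algebra_morphism_def basis_mult[symmetric] simp del: sum_list.Cons simp: sum_list.Cons\<close>)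
  then have "D (basis a) = E (basis a)" for a
    using ex_factorization[of a] by auto
  then show "D = E"
    using D E by (intro linear_eq_on_basis) (auto simp: is_coproduct_def algebra_morphism_def)
qed

lemma is_coproduct_coproduct: "is_coproduct coproduct"
  unfolding coproduct_def by (rule theI'[OF ex1_is_coproduct])

end

theory Submission
  imports Defs
begin

text \<open>
  Both sides are algebra morphisms, so it suffices to compare them on a generator \<open>H\<^sub>\<pi>\<close>.
  Cutting a diagram vertically between two columns shows that \<open>\<bullet>\<close> preserves
  \<open>\<otimes>\<close>-irreducibility, and merging two pairs of blocks can be done in either order, so \<open>\<bullet>\<close> is
  associative. Hence both sides send \<open>H\<^sub>\<pi>\<close> to the sum over all triples of
  \<open>\<otimes>\<close>-irreducible or empty diagrams whose \<open>\<bullet>\<close>-product is \<open>\<pi>\<close>.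
\<close>

section \<open>The bullet product\<close>

lemma bullet_0_left [simp]: "diagram_bullet 0 x = x"
  unfolding zero_diagram_def by transfer auto

lemma bullet_0_right [simp]: "diagram_bullet x 0 = x"
  \<comment> \<open>The test on the first order comes first, so for \<open>x\<close> of order 0 the
    result is the second argument; it equals \<open>x\<close> because the empty set has only the
    empty partition.\<close>
  unfolding zero_diagram_def by transfer (auto simp: vertices_def partition_on_empty)

lemma blocks_bullet:
  assumes "x \<noteq> 0" "y \<noteq> 0"
  shows "blocks (diagram_bullet x y) =
    merge_blocks (Primed (diagram_order x)) (Primed (diagram_order x + 1)) (blocks (x + y))"
proof -
  have "diagram_order x \<noteq> 0" "diagram_order y \<noteq> 0" using assms by simp_all
  then show ?thesis unfolding blocks_add by transfer auto
qed

text \<open>Two successive merges are computed explicitly, and the result is symmetric in the two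
  pairs. If some block meets both pairs, everything touched becomes one block; otherwise two
  separate unions are formed.\<close>

lemma merge_blocks_commute:
  "merge_blocks u v (merge_blocks w x P) = merge_blocks w x (merge_blocks u v P)"
proof -
  define M where "M t B \<longleftrightarrow> fst t \<in> B \<or> snd t \<in> B" for t :: "vertex \<times> vertex" and B
  have merge: "merge_blocks (fst t) (snd t) R = {B \<in> R. \<not> M t B} \<union> {\<Union>{B \<in> R. M t B}}" for t R
    by (simp add: merge_blocks_def M_def)
  have M_Union: "M t (\<Union>R) \<longleftrightarrow> (\<exists>B\<in>R. M t B)" for t R
    by (auto simp: M_def)
  have twice: "merge_blocks (fst s) (snd s) (merge_blocks (fst t) (snd t) P) =
    {B \<in> P. \<not> M s B \<and> \<not> M t B} \<union>
    (if \<exists>B\<in>P. M s B \<and> M t B then {\<Union>{B \<in> P. M s B \<or> M t B}}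
     else {\<Union>{B \<in> P. M s B}, \<Union>{B \<in> P. M t B}})" for s t
  proof (cases "\<exists>B\<in>P. M s B \<and> M t B")
    case True
    \<comment> \<open>The block created by the first merge is itself caught by the second merge
      exactly when some original block meets both pairs.\<close>
    then have touch: "M s (\<Union>{B \<in> P. M t B})" by (auto simp: M_Union)
    have "{B \<in> {B \<in> P. \<not> M t B} \<union> {\<Union>{B \<in> P. M t B}}. \<not> M s B} = {B \<in> P. \<not> M s B \<and> \<not> M t B}"
      using touch by blast
    moreover have "\<Union>{B \<in> {B \<in> P. \<not> M t B} \<union> {\<Union>{B \<in> P. M t B}}. M s B} = \<Union>{B \<in> P. M s B \<or> M t B}"
      using touch by blast
    ultimately show ?thesis using True by (simp only: merge if_True)
  next
    case False
    then have touch: "\<not> M s (\<Union>{B \<in> P. M t B})" by (auto simp: M_Union)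
    have "{B \<in> {B \<in> P. \<not> M t B} \<union> {\<Union>{B \<in> P. M t B}}. \<not> M s B} =
        {B \<in> P. \<not> M s B \<and> \<not> M t B} \<union> {\<Union>{B \<in> P. M t B}}"
      using touch by blast
    moreover have "{B \<in> {B \<in> P. \<not> M t B} \<union> {\<Union>{B \<in> P. M t B}}. M s B} = {B \<in> P. M s B}"
      using touch False by blast
    ultimately show ?thesis using False by (simp only: merge if_False) blast
  qed
  show ?thesis
    using twice[of "(u, v)" "(w, x)"] twice[of "(w, x)" "(u, v)"]
    by (simp only: fst_conv snd_conv conj_commute disj_commute insert_commute cong: if_cong)
qed

text \<open>The shifted blocks avoid \<open>u\<close> and \<open>v\<close>, so the merge takes place
  entirely among the blocks of \<open>P\<close>.\<close>

lemma juxtapose_merge_blocks_left: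
  assumes "\<And>B. B \<in> Q \<Longrightarrow> u \<notin> shift n ` B \<and> v \<notin> shift n ` B"
  shows "juxtapose n (merge_blocks u v P) Q = merge_blocks u v (juxtapose n P Q)"
proof -
  have "{B \<in> juxtapose n P Q. u \<in> B \<or> v \<in> B} = {B \<in> P. u \<in> B \<or> v \<in> B}"
    and "{B \<in> juxtapose n P Q. u \<notin> B \<and> v \<notin> B} =
      {B \<in> P. u \<notin> B \<and> v \<notin> B} \<union> (\<lambda>B. shift n ` B) ` Q"
    using assms unfolding juxtapose_def by blast+
  then show ?thesis unfolding merge_blocks_def by (auto simp: juxtapose_def)
qed

text \<open>The blocks of \<open>P\<close> avoid the shifted pair, so the merge takes place entirely
  in the shifted copy of \<open>Q\<close>, and \<open>shift n\<close> is injective.\<close>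

lemma juxtapose_merge_blocks_right:
  assumes "\<And>B. B \<in> P \<Longrightarrow> shift n u \<notin> B \<and> shift n v \<notin> B"
  shows "juxtapose n P (merge_blocks u v Q) =
    merge_blocks (shift n u) (shift n v) (juxtapose n P Q)"
proof -
  have mem: "shift n w \<in> shift n ` B \<longleftrightarrow> w \<in> B" for w B
    by (rule inj_image_mem_iff[OF inj_shift])
  have 1: "{B \<in> juxtapose n P Q. shift n u \<in> B \<or> shift n v \<in> B} =
      (\<lambda>B. shift n ` B) ` {B \<in> Q. u \<in> B \<or> v \<in> B}"
    using assms by (auto simp: juxtapose_def mem inj_eq[OF inj_shift])
  have 2: "{B \<in> juxtapose n P Q. shift n u \<notin> B \<and> shift n v \<notin> B} =
      P \<union> (\<lambda>B. shift n ` B) ` {B \<in> Q. u \<notin> B \<and> v \<notin> B}"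
    using assms by (auto simp: juxtapose_def mem inj_eq[OF inj_shift])
  show ?thesis
    unfolding merge_blocks_def 1 2 unfolding juxtapose_def by (simp add: image_Un image_Union Un_assoc)
qed

text \<open>For nonempty factors both sides arise from \<open>x + y + z\<close> by merging at the
  two seams, in opposite orders. Empty factors are treated apart because the bullet product is then
  not given by a merge.\<close>

lemma bullet_assoc:
  "diagram_bullet (diagram_bullet x y) z = diagram_bullet x (diagram_bullet y z)"
proof (cases "x = 0 \<or> y = 0 \<or> z = 0")
  case True
  then show ?thesis by auto
next
  case False
  then have nz: "x \<noteq> 0" "y \<noteq> 0" "z \<noteq> 0" by auto
  let ?k = "diagram_order x" and ?l = "diagram_order y"
  have pos: "?k > 0" "?l > 0" using nz by (metis neq0_conv order_eq_0_iff)+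
  have bnz: "diagram_bullet x y \<noteq> 0" "diagram_bullet y z \<noteq> 0"
    using pos by (metis add_is_0 order_eq_0_iff order_bullet less_irrefl)+
  let ?u = "Primed ?k" and ?v = "Primed (?k + 1)"
  let ?w = "Primed (?k + ?l)" and ?t = "Primed (?k + ?l + 1)"
  have L: "blocks (diagram_bullet x y + z) = merge_blocks ?u ?v (blocks (x + y + z))"
    unfolding blocks_add[of "diagram_bullet x y"] blocks_add[of "x + y"] order_bullet order_add
      blocks_bullet[OF nz(1,2)]
  proof (rule juxtapose_merge_blocks_left)
    fix B assume "B \<in> blocks z"
    then have "shift (?k + ?l) ` B \<subseteq> shift (?k + ?l) ` vertices (diagram_order z)"
      using block_subset by blast
    \<comment> \<open>As \<open>?l > 0\<close>, column \<open>?k + 1\<close> still belongs to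
      \<open>y\<close>, so the first seam lies left of \<open>z\<close>.\<close>
    moreover have "?u \<in> vertices (?k + ?l)" "?v \<in> vertices (?k + ?l)"
      using pos by (auto simp: vertices_def)
    ultimately show "?u \<notin> shift (?k + ?l) ` B \<and> ?v \<notin> shift (?k + ?l) ` B"
      using vertices_shift_disjoint[of "?k + ?l" "diagram_order z"] by blast
  qed
  have R: "blocks (x + diagram_bullet y z) = merge_blocks ?w ?t (blocks (x + y + z))"
  proof -
    have sh: "shift ?k (Primed ?l) = ?w" "shift ?k (Primed (?l + 1)) = ?t" by simp_all
    show ?thesis
      unfolding blocks_add[of x] blocks_bullet[OF nz(2,3)] add.assoc[of x] sh[symmetric]
    proof (rule juxtapose_merge_blocks_right)
      fix B assume "B \<in> blocks x"
      then have "B \<subseteq> vertices ?k" by (rule block_subset)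
      \<comment> \<open>Again by \<open>?l > 0\<close>, the second seam lies strictly to the right
        of \<open>x\<close>.\<close>
      moreover have "?w \<notin> vertices ?k" "?t \<notin> vertices ?k"
        using pos by (auto simp: vertices_def)
      ultimately show "shift ?k (Primed ?l) \<notin> B \<and> shift ?k (Primed (?l + 1)) \<notin> B"
        unfolding sh by blast
    qed
  qed
  show ?thesis
  proof (rule diagram_eqI)
    show "blocks (diagram_bullet (diagram_bullet x y) z) = blocks (diagram_bullet x (diagram_bullet y z))"
      unfolding blocks_bullet[OF bnz(1) nz(3)] blocks_bullet[OF nz(1) bnz(2)] L R order_bullet
      by (rule merge_blocks_commute)
  qed (simp add: order_bullet)
qed

section \<open>Vertical cuts and irreducibility\<close>

lemma ex_diagram:
  assumes "partition_on (vertices k) P"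
  obtains x where "diagram_order x = k" "blocks x = P"
proof -
  have "\<exists>x. diagram_order x = k \<and> blocks x = P"
    using assms by transfer auto
  then show ?thesis using that by blast
qed

text \<open>A diagram splits at any cut that no block crosses: the blocks left of the cut form
  \<open>y\<close>, and the remaining ones, moved back by \<open>j\<close>, form
  \<open>z\<close>.\<close>

lemma ex_tensor_factors:
  assumes le: "j \<le> diagram_order x"
    and cut: "\<And>B. B \<in> blocks x \<Longrightarrow> B \<subseteq> vertices j \<or> B \<inter> vertices j = {}"
  obtains y z where "x = y + z" "diagram_order y = j"
proof -
  obtain l where n: "diagram_order x = j + l" using le le_Suc_ex by blast
  define P where "P = {B \<in> blocks x. B \<subseteq> vertices j}"
  \<comment> \<open>The right part is described as a preimage under \<open>shift j\<close>, which
    avoids an explicit inverse shift.\<close>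
  define Q where "Q = {B. B \<subseteq> vertices l \<and> shift j ` B \<in> blocks x}"
  have Ux: "\<Union>(blocks x) = vertices j \<union> shift j ` vertices l"
    using partition_onD1[OF partition_on_blocks[of x]] by (simp add: n vertices_add)
  have disj: "p \<inter> q = {}" if "p \<in> blocks x" "q \<in> blocks x" "p \<noteq> q" for p q
    using partition_onD2[OF partition_on_blocks[of x]] that unfolding disjoint_def by blast
  \<comment> \<open>Conversely, a block not left of the cut lies wholly to its right, hence is the
    shift of a member of \<open>Q\<close>.\<close>
  have right: "\<exists>B\<in>Q. C = shift j ` B" if C: "C \<in> blocks x" "\<not> C \<subseteq> vertices j" for C
  proof -
    have "C \<subseteq> shift j ` vertices l" using cut[OF C(1)] C Ux by blast
    then show ?thesis using C(1) unfolding Q_def subset_image_iff by blast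
  qed
  have "partition_on (vertices j) P"
  proof (rule partition_onI)
    show "\<Union>P = vertices j"
    proof
      show "vertices j \<subseteq> \<Union>P"
      proof
        fix v assume v: "v \<in> vertices j"
        then obtain B where "B \<in> blocks x" "v \<in> B" using Ux by blast
        then show "v \<in> \<Union>P" using cut[of B] v unfolding P_def by blast
      qed
    qed (auto simp: P_def)
    show "disjnt p q" if "p \<in> P" "q \<in> P" "p \<noteq> q" for p q
      using that disj[of p q] unfolding P_def disjnt_def by blast
    show "{} \<notin> P" unfolding P_def using block_nonempty by blast
  qed
  then obtain y where y: "diagram_order y = j" "blocks y = P" by (rule ex_diagram)
  have "partition_on (vertices l) Q"
  proof (rule partition_onI)
    show "\<Union>Q = vertices l"
    proof
      show "vertices l \<subseteq> \<Union>Q"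
      proof
        fix v assume v: "v \<in> vertices l"
        then obtain C where C: "C \<in> blocks x" "shift j v \<in> C" using Ux by blast
        have "shift j v \<notin> vertices j" using vertices_shift_disjoint[of j l] v by blast
        then obtain B where "B \<in> Q" "C = shift j ` B" using right[OF C(1)] C(2) by blast
        then show "v \<in> \<Union>Q" using C(2) by (auto simp: inj_image_mem_iff[OF inj_shift])
      qed
    qed (auto simp: Q_def)
    show "disjnt p q" if pq: "p \<in> Q" "q \<in> Q" "p \<noteq> q" for p q
    proof -
      have "shift j ` p \<noteq> shift j ` q" using pq(3) by (simp add: inj_image_eq_iff[OF inj_shift])
      then have "shift j ` p \<inter> shift j ` q = {}"
        using disj[of "shift j ` p" "shift j ` q"] pq(1,2) unfolding Q_def by blast
      then show ?thesis unfolding disjnt_def by blast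
    qed
    show "{} \<notin> Q" unfolding Q_def using block_nonempty by blast
  qed
  then obtain z where z: "diagram_order z = l" "blocks z = Q" by (rule ex_diagram)
  have "blocks x = juxtapose j P Q"
  proof
    show "blocks x \<subseteq> juxtapose j P Q"
      using right unfolding juxtapose_def P_def by blast
    show "juxtapose j P Q \<subseteq> blocks x"
      unfolding juxtapose_def P_def Q_def by blast
  qed
  then have "x = y + z"
    by (intro diagram_eqI) (simp_all add: blocks_add n y z)
  then show ?thesis using that y(1) by blast
qed

text \<open>Irreducibility turns into a condition that can be tested cut by cut: some block crosses
  each cut between two columns.\<close>

lemma tensor_irreducible_iff:
  "tensor_irreducible x \<longleftrightarrow>
    (\<forall>j. 0 < j \<and> j < diagram_order x \<longrightarrow>
      (\<exists>B\<in>blocks x. \<not> B \<subseteq> vertices j \<and> B \<inter> vertices j \<noteq> {}))"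
proof (intro iffI allI impI)
  fix j assume irr: "tensor_irreducible x" and j: "0 < j \<and> j < diagram_order x"
  show "\<exists>B\<in>blocks x. \<not> B \<subseteq> vertices j \<and> B \<inter> vertices j \<noteq> {}"
  proof (rule ccontr)
    assume "\<not> ?thesis"
    then obtain y z where yz: "x = y + z" "diagram_order y = j"
      using ex_tensor_factors[of j x] j by (metis less_imp_le)
    then have "y \<noteq> 0" "z \<noteq> 0" using j by auto
    then show False using irr yz(1) unfolding tensor_irreducible_def by blast
  qed
next
  assume cross: "\<forall>j. 0 < j \<and> j < diagram_order x \<longrightarrow>
    (\<exists>B\<in>blocks x. \<not> B \<subseteq> vertices j \<and> B \<inter> vertices j \<noteq> {})"
  show "tensor_irreducible x"
    unfolding tensor_irreducible_def
  proof clarify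
    fix y z :: diagram assume "y \<noteq> 0" "z \<noteq> 0" and x: "x = y + z"
    then have "diagram_order y > 0" "diagram_order z > 0" by (metis neq0_conv order_eq_0_iff)+
    then obtain B where B: "B \<in> blocks (y + z)" "\<not> B \<subseteq> vertices (diagram_order y)"
        "B \<inter> vertices (diagram_order y) \<noteq> {}"
      using cross[rule_format, of "diagram_order y"] x by auto
    \<comment> \<open>A block reaching beyond the columns of \<open>y\<close> comes from
      \<open>z\<close>, and as a shifted block it cannot meet the columns of
      \<open>y\<close>.\<close>
    then obtain C where "C \<in> blocks z" "B = shift (diagram_order y) ` C"
      using block_subset[of B y] by (auto simp: blocks_add juxtapose_def)
    then show False
      using B(3) block_subset[of C z] vertices_shift_disjoint[of "diagram_order y" "diagram_order z"]
      by blast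
  qed
qed

lemma tensor_irreducible_0 [simp]: "tensor_irreducible 0"
  by (simp add: tensor_irreducible_iff)

text \<open>A cut inside one factor is crossed by a block of that factor, and merging only enlarges
  it; the cut at the seam is crossed by the merged block. This keeps regrouped factorizations
  admissible in the comparison of the iterated coproducts.\<close>

lemma tensor_irreducible_bullet:
  assumes x: "tensor_irreducible x" and y: "tensor_irreducible y"
  shows "tensor_irreducible (diagram_bullet x y)"
proof (cases "x = 0 \<or> y = 0")
  case True
  then show ?thesis using x y by auto
next
  case False
  then have nz: "x \<noteq> 0" "y \<noteq> 0" by auto
  let ?k = "diagram_order x"
  have kpos: "?k > 0" using nz(1) by (metis neq0_conv order_eq_0_iff)
  have coarser: "\<exists>C\<in>blocks (diagram_bullet x y). B \<subseteq> C" if "B \<in> blocks (x + y)" for B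
    using that unfolding blocks_bullet[OF nz] merge_blocks_def by blast
  have "\<exists>B\<in>blocks (diagram_bullet x y). \<not> B \<subseteq> vertices j \<and> B \<inter> vertices j \<noteq> {}"
    if j: "0 < j" "j < diagram_order (diagram_bullet x y)" for j
  proof -
    \<comment> \<open>The cut falls inside \<open>x\<close>, at the seam, or inside \<open>y\<close>
      after its column \<open>m\<close>.\<close>
    consider "j < ?k" | "j = ?k" | m where "j = ?k + m" "m > 0"
      by (metis less_imp_add_positive linorder_neqE_nat)
    then show ?thesis
    proof cases
      case 1
      then obtain B where B: "B \<in> blocks x" "\<not> B \<subseteq> vertices j" "B \<inter> vertices j \<noteq> {}"
        using x j unfolding tensor_irreducible_iff by blast
      then have "B \<in> blocks (x + y)" by (simp add: blocks_add juxtapose_def)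
      then obtain C where C: "C \<in> blocks (diagram_bullet x y)" "B \<subseteq> C"
        using coarser by blast
      have "\<not> C \<subseteq> vertices j" "C \<inter> vertices j \<noteq> {}" using B(2,3) C(2) by blast+
      then show ?thesis using C(1) by blast
    next
      case 2
      let ?u = "Primed ?k" and ?v = "Primed (?k + 1)"
      \<comment> \<open>The merged block: it contains one vertex on each side of the seam.\<close>
      let ?C = "\<Union>{B \<in> blocks (x + y). ?u \<in> B \<or> ?v \<in> B}"
      have "?u \<in> vertices (?k + diagram_order y)" "?v \<in> vertices (?k + diagram_order y)"
        using j kpos unfolding 2 order_bullet by (auto simp: vertices_def)
      then have "?u \<in> \<Union>(blocks (x + y))" "?v \<in> \<Union>(blocks (x + y))"
        using partition_onD1[OF partition_on_blocks[of "x + y"]] by simp_all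
      then have "?u \<in> ?C" "?v \<in> ?C" by blast+
      moreover have "?u \<in> vertices j" "?v \<notin> vertices j"
        using kpos unfolding 2 by (auto simp: vertices_def)
      ultimately have "\<not> ?C \<subseteq> vertices j" "?C \<inter> vertices j \<noteq> {}" by blast+
      moreover have "?C \<in> blocks (diagram_bullet x y)"
        unfolding blocks_bullet[OF nz] merge_blocks_def by (rule UnI2) (rule singletonI)
      ultimately show ?thesis by (intro bexI[of _ ?C] conjI)
    next
      case 3
      then have "m < diagram_order y" using j by (simp add: order_bullet)
      then obtain B where B: "B \<in> blocks y" "\<not> B \<subseteq> vertices m" "B \<inter> vertices m \<noteq> {}"
        using y 3(2) unfolding tensor_irreducible_iff by blast
      \<comment> \<open>The shift carries the cut of \<open>y\<close> at \<open>m\<close> to the cut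
        at \<open>?k + m\<close>.\<close>
      have shifted: "shift ?k v \<in> vertices j \<longleftrightarrow> v \<in> vertices m"
        if "v \<in> vertices (diagram_order y)" for v
        using that vertices_shift_disjoint[of ?k "diagram_order y"]
        unfolding 3(1) vertices_add by (auto simp: inj_image_mem_iff[OF inj_shift])
      obtain v w where vw: "v \<in> B" "v \<in> vertices m" "w \<in> B" "w \<notin> vertices m"
        using B by blast
      then have "shift ?k v \<in> vertices j" "shift ?k w \<notin> vertices j"
        using shifted block_subset[OF B(1)] by blast+
      moreover have "shift ?k ` B \<in> blocks (x + y)"
        using B(1) by (simp add: blocks_add juxtapose_def)
      then obtain C where C: "C \<in> blocks (diagram_bullet x y)" "shift ?k ` B \<subseteq> C"
        using coarser by blast
      have "shift ?k v \<in> C" "shift ?k w \<in> C" using vw C(2) by blast+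
      ultimately have "\<not> C \<subseteq> vertices j" "C \<inter> vertices j \<noteq> {}" by blast+
      then show ?thesis using C(1) by blast
    qed
  qed
  then show ?thesis unfolding tensor_irreducible_iff by blast
qed

section \<open>Tensor products of algebra morphisms\<close>

lemma scale_conv_mult: "scale c x = Poly_Mapping.single 0 c * x"
  for x :: "'a::monoid_add \<Rightarrow>\<^sub>0 'k::field"
  unfolding scale_def by (rule mult_map_scale_conv_mult)

lemma scale_mult_left: "scale c x * y = scale c (x * y)"
  for x y :: "'a::monoid_add \<Rightarrow>\<^sub>0 'k::field"
  by (simp add: scale_conv_mult mult.assoc)

lemma linear_mult_right:
  fixes x :: "'a::monoid_add \<Rightarrow>\<^sub>0 'k::field"
  shows "Vector_Spaces.linear scale scale (\<lambda>z. z * x)"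
  by unfold_locales (simp_all add: distrib_right scale_mult_left)

text \<open>Scalars are central: right multiplication by \<open>Poly_Mapping.single 0 c\<close>
  agrees with \<open>scale c\<close> on basis vectors, since 0 is neutral, and therefore everywhere.
  The rest is associativity.\<close>

lemma mult_scale_right: "x * scale c y = scale c (x * y)"
  for x y :: "'a::monoid_add \<Rightarrow>\<^sub>0 'k::field"
proof -
  interpret r: Vector_Spaces.linear scale scale "\<lambda>z. z * Poly_Mapping.single 0 c :: 'a \<Rightarrow>\<^sub>0 'k"
    by (rule linear_mult_right)
  have "(\<lambda>z. z * Poly_Mapping.single 0 c) = (scale c :: ('a \<Rightarrow>\<^sub>0 'k) \<Rightarrow> _)"
    by (rule linear_eq_on_basis[OF linear_mult_right])
      (simp_all add: free_space.linear_scale_self basis_def mult_single scale_conv_mult)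
  then have "x * Poly_Mapping.single 0 c = scale c x" by (rule fun_cong)
  then show ?thesis by (metis mult.assoc scale_conv_mult)
qed

lemma linear_mult_left:
  fixes x :: "'a::monoid_add \<Rightarrow>\<^sub>0 'k::field"
  shows "Vector_Spaces.linear scale scale (\<lambda>z. x * z)"
  by unfold_locales (simp_all add: distrib_left mult_scale_right)

lemma linear_compose2:
  assumes "Vector_Spaces.linear scale scale f" "Vector_Spaces.linear scale scale g"
  shows "Vector_Spaces.linear scale scale (\<lambda>x. g (f x))"
  using Vector_Spaces.linear_compose[OF assms] by (simp add: comp_def)

text \<open>Linear maps agreeing on the basis are equal; this is used in the second argument with a
  basis vector in the first, and then in the first argument.\<close>

lemma bilinear_eq_on_basis:
  assumes "\<And>y. Vector_Spaces.linear scale scale (\<lambda>x. f x y)"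
    "\<And>x. Vector_Spaces.linear scale scale (f x)"
    "\<And>y. Vector_Spaces.linear scale scale (\<lambda>x. g x y)"
    "\<And>x. Vector_Spaces.linear scale scale (g x)"
    and "\<And>a b. f (basis a) (basis b) = g (basis a) (basis b)"
  shows "f x y = g x y"
proof -
  have "f (basis a) = g (basis a)" for a
    by (rule linear_eq_on_basis) (use assms in auto)
  then have "(\<lambda>x. f x y) = (\<lambda>x. g x y)"
    by (intro linear_eq_on_basis assms) simp
  then show ?thesis by (rule fun_cong)
qed

text \<open>Existence half of the universal property of a monoid algebra: a monoid homomorphism into
  the multiplicative monoid of an algebra extends to an algebra morphism.\<close>

lemma algebra_morphism_linear_extension:
  fixes g :: "'a::monoid_add \<Rightarrow> ('b::monoid_add \<Rightarrow>\<^sub>0 'k::field)"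
  assumes "g 0 = 1" "\<And>a b. g (a + b) = g a * g b"
  shows "algebra_morphism (linear_extension g)"
  unfolding algebra_morphism_def
proof (intro conjI allI linear_linear_extension)
  show "linear_extension g 1 = 1" by (simp add: assms(1) flip: basis_zero)
  note L = linear_linear_extension[of g]
  show "linear_extension g (x * y) = linear_extension g x * linear_extension g y" for x y
    by (rule bilinear_eq_on_basis[where f = "\<lambda>x y. linear_extension g (x * y)"
          and g = "\<lambda>x y. linear_extension g x * linear_extension g y"])
      (auto intro: linear_compose2[OF linear_mult_left L] linear_compose2[OF linear_mult_right L]
        linear_compose2[OF L linear_mult_left] linear_compose2[OF L linear_mult_right]
        simp: basis_mult assms(2))
qed

lemma algebra_morphismD:
  assumes "algebra_morphism f"
  shows "Vector_Spaces.linear scale scale f" "f 1 = 1" "f (x * y) = f x * f y"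
  using assms by (auto simp: algebra_morphism_def)

lemma algebra_morphism_comp:
  assumes "algebra_morphism f" "algebra_morphism g"
  shows "algebra_morphism (g \<circ> f)"
  using assms Vector_Spaces.linear_compose[of scale scale f scale g]
  by (simp add: algebra_morphism_def)

lemma algebra_morphism_id: "algebra_morphism id"
  unfolding algebra_morphism_def using free_space.linear_id by (simp add: id_def)

text \<open>The canonical map sending \<open>x\<close> to the tensor of \<open>x\<close> with the
  unit; \<open>embed_snd\<close> is its counterpart for the other factor.\<close>

definition embed_fst :: "('a \<Rightarrow>\<^sub>0 'k::field) \<Rightarrow> ('a \<times> 'b::monoid_add \<Rightarrow>\<^sub>0 'k)" where
  "embed_fst = linear_extension (\<lambda>a. basis (a, 0))"

definition embed_snd :: "('b \<Rightarrow>\<^sub>0 'k::field) \<Rightarrow> ('a::monoid_add \<times> 'b \<Rightarrow>\<^sub>0 'k)" where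
  "embed_snd = linear_extension (\<lambda>b. basis (0, b))"

lemma embed_basis [simp]:
  "embed_fst (basis a) = basis (a, 0)" "embed_snd (basis b) = basis (0, b)"
  by (simp_all add: embed_fst_def embed_snd_def)

lemma linear_embed_fst: "Vector_Spaces.linear scale scale embed_fst"
  unfolding embed_fst_def by (rule linear_linear_extension)

lemma linear_embed_snd: "Vector_Spaces.linear scale scale embed_snd"
  unfolding embed_snd_def by (rule linear_linear_extension)

lemma algebra_morphism_embed_fst: "algebra_morphism embed_fst"
  unfolding embed_fst_def
  by (rule algebra_morphism_linear_extension) (simp_all add: basis_mult basis_zero flip: zero_prod_def)

lemma algebra_morphism_embed_snd: "algebra_morphism embed_snd"
  unfolding embed_snd_def
  by (rule algebra_morphism_linear_extension) (simp_all add: basis_mult basis_zero flip: zero_prod_def)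

lemma linear_tensor_left: "Vector_Spaces.linear scale scale (\<lambda>x. tensor x y)"
  unfolding tensor_def by (rule linear_linear_extension)

text \<open>\<open>tensor\<close> is defined by extension in its first argument, so linearity in the
  second is checked termwise in the sum over the keys of \<open>x\<close>.\<close>

lemma linear_tensor_right: "Vector_Spaces.linear scale scale (tensor x)"
proof unfold_locales
  fix y z and c
  interpret l: Vector_Spaces.linear scale scale "linear_extension (\<lambda>b. basis (a, b))" for a
    by (rule linear_linear_extension)
  show "tensor x (y + z) = tensor x y + tensor x z"
    unfolding tensor_def
    by (simp add: linear_extension_def[of _ x] l.add free_space.scale_right_distrib sum.distrib)
  show "tensor x (scale c y) = scale c (tensor x y)"
    unfolding tensor_def
    by (simp add: linear_extension_def[of _ x] l.scale free_space.scale_sum_right mult.commute)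
qed

text \<open>On basis vectors this is \<open>(a, 0) + (0, b) = (a, b)\<close>. It turns statements
  about tensors into computations in one associative algebra.\<close>

lemma tensor_eq_embed_mult: "tensor x y = embed_fst x * embed_snd y"
  by (rule bilinear_eq_on_basis[where g = "\<lambda>x y. embed_fst x * embed_snd y"])
    (auto intro: linear_tensor_left linear_tensor_right
      linear_compose2[OF linear_embed_snd linear_mult_left]
      linear_compose2[OF linear_embed_fst linear_mult_right] simp: basis_mult)

text \<open>The two copies occupy different components of the pair, so on basis vectors both
  products have index \<open>(a, b)\<close>, even where the monoids are noncommutative.\<close>

lemma embed_commute: "embed_snd y * embed_fst x = embed_fst x * embed_snd y"
  by (rule bilinear_eq_on_basis[where f = "\<lambda>x y. embed_snd y * embed_fst x"
        and g = "\<lambda>x y. embed_fst x * embed_snd y"])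
    (auto intro: linear_compose2[OF linear_embed_snd linear_mult_left]
      linear_compose2[OF linear_embed_fst linear_mult_right]
      linear_compose2[OF linear_embed_snd linear_mult_right]
      linear_compose2[OF linear_embed_fst linear_mult_left] simp: basis_mult)

lemma tensor_mult: "tensor (x * x') (y * y') = tensor x y * tensor x' y'"
proof -
  \<comment> \<open>Only the two middle factors, \<open>embed_fst x'\<close> and
    \<open>embed_snd y\<close>, have to change places.\<close>
  have "tensor (x * x') (y * y') = embed_fst x * (embed_fst x' * embed_snd y) * embed_snd y'"
    by (simp add: tensor_eq_embed_mult mult.assoc
        algebra_morphismD(3)[OF algebra_morphism_embed_fst]
        algebra_morphismD(3)[OF algebra_morphism_embed_snd])
  also have "\<dots> = tensor x y * tensor x' y'"
    unfolding embed_commute[symmetric] by (simp add: tensor_eq_embed_mult mult.assoc)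
  finally show ?thesis .
qed

section \<open>Tensor products of maps and the associativity isomorphism\<close>

lemma tensor_map_basis [simp]:
  "tensor_map f g (basis (a, b)) = tensor (f (basis a)) (g (basis b))"
  by (simp add: tensor_map_def)

lemma linear_tensor_map: "Vector_Spaces.linear scale scale (tensor_map f g)"
  unfolding tensor_map_def by (rule linear_linear_extension)

text \<open>By \<open>tensor_mult\<close>, the values on basis pairs form a monoid homomorphism,
  which then extends.\<close>

lemma algebra_morphism_tensor_map:
  assumes f: "algebra_morphism f" and g: "algebra_morphism g"
  shows "algebra_morphism (tensor_map f g)"
  unfolding tensor_map_def
proof (rule algebra_morphism_linear_extension)
  show "(case 0 of (a, b) \<Rightarrow> tensor (f (basis a)) (g (basis b))) = 1"
    by (simp add: zero_prod_def basis_zero algebra_morphismD(2)[OF f] algebra_morphismD(2)[OF g]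
        tensor_eq_embed_mult algebra_morphismD(2)[OF algebra_morphism_embed_fst]
        algebra_morphismD(2)[OF algebra_morphism_embed_snd])
  show "(case p + q of (a, b) \<Rightarrow> tensor (f (basis a)) (g (basis b))) =
    (case p of (a, b) \<Rightarrow> tensor (f (basis a)) (g (basis b))) *
    (case q of (a, b) \<Rightarrow> tensor (f (basis a)) (g (basis b)))" for p q
    by (cases p; cases q)
      (simp add: tensor_mult algebra_morphismD(3)[OF f] algebra_morphismD(3)[OF g]
        flip: basis_mult)
qed

lemma tensor_assoc_basis [simp]: "tensor_assoc (basis (p, c)) = basis (fst p, snd p, c)"
  by (simp add: tensor_assoc_def split_beta)

lemma linear_tensor_assoc: "Vector_Spaces.linear scale scale tensor_assoc"
  unfolding tensor_assoc_def by (rule linear_linear_extension)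

lemma algebra_morphism_tensor_assoc: "algebra_morphism tensor_assoc"
  unfolding tensor_assoc_def
  by (rule algebra_morphism_linear_extension)
    (auto simp: basis_mult zero_prod_def split: prod.splits simp flip: basis_zero)

section \<open>Coassociativity\<close>

text \<open>Every diagram is a finite tensor product of generators, so its basis vector is a product
  of generator basis vectors.\<close>

lemma algebra_morphism_eq_on_generators:
  assumes f: "algebra_morphism f" and g: "algebra_morphism g"
    and eq: "\<And>\<pi>. generator \<pi> \<Longrightarrow> f (basis \<pi>) = g (basis \<pi>)"
  shows "f = g"
proof (rule linear_eq_on_basis[OF algebra_morphismD(1)[OF f] algebra_morphismD(1)[OF g]])
  fix \<pi>
  have "f (basis (sum_list xs)) = g (basis (sum_list xs))" if "\<forall>x\<in>set xs. generator x" for xs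
    using that
  proof (induction xs)
    case Nil
    show ?case
      by (simp add: basis_zero algebra_morphismD(2)[OF f] algebra_morphismD(2)[OF g])
  next
    case (Cons x xs)
    then show ?case
      by (simp add: eq algebra_morphismD(3)[OF f] algebra_morphismD(3)[OF g] flip: basis_mult)
  qed
  then show "f (basis \<pi>) = g (basis \<pi>)" using ex_factorization[of \<pi>] by auto
qed

text \<open>The alternative of an empty factor is absorbed because the empty diagram is vacuously
  irreducible.\<close>

lemma bullet_factorizations_iff:
  "(x, y) \<in> bullet_factorizations \<pi> \<longleftrightarrow>
    tensor_irreducible x \<and> tensor_irreducible y \<and> diagram_bullet x y = \<pi>"
  by (auto simp: bullet_factorizations_def)

lemma bullet_eq_0_iff [simp]: "diagram_bullet x y = 0 \<longleftrightarrow> x = 0 \<and> y = 0"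
  by (metis add_is_0 order_bullet order_eq_0_iff)

text \<open>The generator formula also holds for the empty diagram, whose only factorization is
  \<open>(0, 0)\<close>. This is required because a factor to which the coproduct is applied again
  may be empty.\<close>

lemma coproduct_basis:
  assumes "tensor_irreducible \<pi>"
  shows "coproduct (basis \<pi>) =
    (\<Sum>(x, y)\<in>bullet_factorizations \<pi>. basis (x, y) :: diagram \<times> diagram \<Rightarrow>\<^sub>0 'k::field)"
proof (cases "\<pi> = 0")
  case True
  have "bullet_factorizations 0 = {(0, 0)}"
    by (auto simp: bullet_factorizations_iff)
  then show ?thesis
    using is_coproduct_coproduct[where 'a = 'k] True by (simp add: is_coproduct_def)
next
  case False
  then show ?thesis
    using is_coproduct_coproduct[where 'a = 'k] assms by (simp add: is_coproduct_def)
qed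

theorem theorem3p7:
  "tensor_assoc \<circ> (tensor_map coproduct id \<circ> coproduct) =
    tensor_map id coproduct \<circ>
      (coproduct :: 'k::field parsym \<Rightarrow> (diagram \<times> diagram \<Rightarrow>\<^sub>0 'k))"
proof (rule algebra_morphism_eq_on_generators)
  have D: "algebra_morphism (coproduct :: 'k parsym \<Rightarrow> _)"
    using is_coproduct_coproduct[where 'a = 'k] by (simp add: is_coproduct_def)
  show "algebra_morphism (tensor_assoc \<circ> (tensor_map coproduct id \<circ> (coproduct :: 'k parsym \<Rightarrow> _)))"
    "algebra_morphism (tensor_map id coproduct \<circ> (coproduct :: 'k parsym \<Rightarrow> _))"
    by (intro algebra_morphism_comp algebra_morphism_tensor_map algebra_morphism_tensor_assoc
        algebra_morphism_id D)+
next
  fix \<pi> :: diagram assume \<pi>: "generator \<pi>"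
  let ?F = bullet_factorizations
  interpret assoc: Vector_Spaces.linear scale scale
    "tensor_assoc :: ((diagram \<times> diagram) \<times> diagram \<Rightarrow>\<^sub>0 'k) \<Rightarrow> _"
    by (rule linear_tensor_assoc)
  interpret left: Vector_Spaces.linear scale scale
    "tensor_map coproduct id :: (diagram \<times> diagram \<Rightarrow>\<^sub>0 'k) \<Rightarrow> ((diagram \<times> diagram) \<times> diagram \<Rightarrow>\<^sub>0 'k)"
    by (rule linear_tensor_map)
  interpret right: Vector_Spaces.linear scale scale
    "tensor_map id coproduct :: (diagram \<times> diagram \<Rightarrow>\<^sub>0 'k) \<Rightarrow> (diagram \<times> diagram \<times> diagram \<Rightarrow>\<^sub>0 'k)"
    by (rule linear_tensor_map)
  interpret tl: Vector_Spaces.linear scale scale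
    "\<lambda>x :: diagram \<times> diagram \<Rightarrow>\<^sub>0 'k. tensor x y" for y :: "'k parsym"
    by (rule linear_tensor_left)
  interpret tr: Vector_Spaces.linear scale scale
    "tensor x :: (diagram \<times> diagram \<Rightarrow>\<^sub>0 'k) \<Rightarrow> _" for x :: "'k parsym"
    by (rule linear_tensor_right)
  \<comment> \<open>The outer index \<open>p\<close> factorizes \<open>\<pi>\<close>, the inner
    index \<open>q\<close> the left component of \<open>p\<close>; that component is irreducible or
    empty, so \<open>coproduct_basis\<close> applies to it.\<close>
  have "tensor_assoc (tensor_map coproduct id (coproduct (basis \<pi>)))
    = (\<Sum>p\<in>?F \<pi>. \<Sum>q\<in>?F (fst p). basis (fst q, snd q, snd p) :: diagram \<times> diagram \<times> diagram \<Rightarrow>\<^sub>0 'k)"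
    unfolding coproduct_basis[OF conjunct2[OF \<pi>]] left.sum assoc.sum
    by (rule sum.cong)
      (auto simp: bullet_factorizations_iff coproduct_basis tl.sum assoc.sum split_beta)
  also have "\<dots> = (\<Sum>(p, q)\<in>Sigma (?F \<pi>) (\<lambda>p. ?F (fst p)). basis (fst q, snd q, snd p))"
    by (simp add: sum.Sigma finite_bullet_factorizations)
  also have "\<dots> = (\<Sum>(p, q)\<in>Sigma (?F \<pi>) (\<lambda>p. ?F (snd p)). basis (fst p, q))"
    \<comment> \<open>Both index sets encode triples \<open>x\<close>, \<open>y\<close>,
      \<open>z\<close>: one stores the product of \<open>x\<close> and \<open>y\<close>, the other
      that of \<open>y\<close> and \<open>z\<close>. Each map discards one product and forms the
      other; the new product is admissible by \<open>tensor_irreducible_bullet\<close>, and the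
      total is still \<open>\<pi>\<close> by \<open>bullet_assoc\<close>.\<close>
    by (rule sum.reindex_bij_witness
        [where i = "\<lambda>((x, _), (y, z)). ((diagram_bullet x y, z), (x, y))"
          and j = "\<lambda>((_, z), (x, y)). ((x, diagram_bullet y z), (y, z))"])
      (auto simp: bullet_factorizations_iff bullet_assoc tensor_irreducible_bullet)
  also have "\<dots> = (\<Sum>p\<in>?F \<pi>. \<Sum>q\<in>?F (snd p). basis (fst p, q))"
    by (simp add: sum.Sigma finite_bullet_factorizations)
  also have "\<dots> = tensor_map id coproduct (coproduct (basis \<pi>))"
    unfolding coproduct_basis[OF conjunct2[OF \<pi>]] right.sum
    by (rule sum.cong)
      (auto simp: bullet_factorizations_iff coproduct_basis tr.sum split_beta)
  finally show "(tensor_assoc \<circ> (tensor_map coproduct id \<circ> coproduct)) (basis \<pi>) =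
      (tensor_map id coproduct \<circ> (coproduct :: 'k parsym \<Rightarrow> _)) (basis \<pi>)"
    by simp
qed

end
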